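(* Every quasi-thin scheme $(\Omega,S)$ with $|S^\perp|\le 1$ (i.e. with at most one orthogonal) is schurian and separable.
   Context: A coherent configuration is a pair $(\Omega,S)$ with $\Omega$ finite and $S$ a partition of $\Omega\times\Omega$ (basic relations) such that $1_\Omega$ is a union of elements of $S$, $S$ is closed under transposition $r\mapsto r^*$, and for $u,v,w\in S$ the number $c_{uv}^w=|\alpha u\cap\gamma v^*|$ is independent of $(\alpha,\gamma)\in w$; it is a scheme if $1_\Omega\in S$. In a scheme, $|\alpha u|$ is independent of $\alpha$ (the valency of $u$); $S_m$ is the set of basic relations of valency $m$; the scheme is quasi-thin if $S=S_1\cup S_2$, and elements of $S_2$ are called thick. For $u,v\in S$, $uv$ denotes the set of basic relations contained in the relational product $u\cdot v$. In a quasi-thin scheme, for each thick $u$ there is a unique basic relation $u^\perp$ (the orthogonal of $u$) with $uu^*=\{1_\Omega,u^\perp\}$; $S^\perp=\{u^\perp:u\in S_2\}$ is the set of orthogonals. Schurian: the basic relations are the orbits on $\Omega\times\Omega$ of some permutation group on $\Omega$. Separable: every algebraic isomorphism (bijection $\varphi:S\to S'$ with $c_{uv}^w=c_{\varphi(u)\varphi(v)}^{\varphi(w)}$) to any coherent configuration $(\Omega',S')$ is induced by a bijection $f:\Omega\to\Omega'$ with $u^f=\varphi(u)$ for all $u\in S$. *)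

theory Defs
  imports "HOL-Algebra.Group_Action" "HOL-Library.Disjoint_Sets"
begin

text \<open>
  For a relation \<open>u\<close> and a point \<open>\<alpha>\<close>, the neighbourhood written \<open>\<alpha>u\<close> on paper is
  \<open>u `` {\<alpha>}\<close>, and the transpose \<open>u*\<close> is \<open>u\<inverse>\<close>.
\<close>

locale coherent_configuration =
  fixes \<Omega> :: "'a set" and S :: "'a rel set"
  assumes finite_points: "finite \<Omega>"
    and partition: "partition_on (\<Omega> \<times> \<Omega>) S"
    and diagonal: "\<exists>T\<subseteq>S. Id_on \<Omega> = \<Union>T"
    and transpose: "r \<in> S \<Longrightarrow> r\<inverse> \<in> S"
    and intersection_numbers:
      "\<lbrakk>u \<in> S; v \<in> S; w \<in> S; (\<alpha>, \<gamma>) \<in> w; (\<alpha>', \<gamma>') \<in> w\<rbrakk> \<Longrightarrow>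
        card (u `` {\<alpha>} \<inter> v\<inverse> `` {\<gamma>}) = card (u `` {\<alpha>'} \<inter> v\<inverse> `` {\<gamma>'})"

locale scheme = coherent_configuration +
  assumes diagonal_basic: "Id_on \<Omega> \<in> S"

text \<open>
  The number \<open>c\<^sub>u\<^sub>v\<^sup>w\<close>. It is meaningful for basic relations \<open>u\<close>, \<open>v\<close>, \<open>w\<close> of a coherent
  configuration; see \<open>intersection_number_eq\<close> below.
\<close>

definition intersection_number :: "'a rel \<Rightarrow> 'a rel \<Rightarrow> 'a rel \<Rightarrow> nat" where
  "intersection_number u v w =
    (THE n. \<forall>(\<alpha>, \<gamma>) \<in> w. card (u `` {\<alpha>} \<inter> v\<inverse> `` {\<gamma>}) = n)"

lemma (in coherent_configuration) intersection_number_eq: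
  assumes "u \<in> S" "v \<in> S" "w \<in> S" "(\<alpha>, \<gamma>) \<in> w"
  shows "intersection_number u v w = card (u `` {\<alpha>} \<inter> v\<inverse> `` {\<gamma>})"
proof -
  have "card (u `` {\<alpha>'} \<inter> v\<inverse> `` {\<gamma>'}) = card (u `` {\<alpha>} \<inter> v\<inverse> `` {\<gamma>})"
    if "(\<alpha>', \<gamma>') \<in> w" for \<alpha>' \<gamma>'
    using intersection_numbers[OF assms(1-3) that assms(4)] .
  then have "\<forall>(\<alpha>', \<gamma>') \<in> w.
      card (u `` {\<alpha>'} \<inter> v\<inverse> `` {\<gamma>'}) = card (u `` {\<alpha>} \<inter> v\<inverse> `` {\<gamma>})"
    by blast
  moreover have "n = card (u `` {\<alpha>} \<inter> v\<inverse> `` {\<gamma>})"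
    if "\<forall>(\<alpha>', \<gamma>') \<in> w. card (u `` {\<alpha>'} \<inter> v\<inverse> `` {\<gamma>'}) = n" for n
    using bspec[OF that assms(4)] by simp
  ultimately show ?thesis
    unfolding intersection_number_def by (rule the_equality)
qed

text \<open>It is meaningful for basic relations of a scheme; see \<open>valency_eq\<close> below.\<close>

definition valency :: "'a set \<Rightarrow> 'a rel \<Rightarrow> nat" where
  "valency \<Omega> u = (THE n. \<forall>\<alpha>\<in>\<Omega>. card (u `` {\<alpha>}) = n)"

lemma (in scheme) valency_eq:
  assumes "u \<in> S" "\<alpha> \<in> \<Omega>"
  shows "valency \<Omega> u = card (u `` {\<alpha>})"
proof -
  have const: "card (u `` {\<beta>}) = card (u `` {\<alpha>})" if "\<beta> \<in> \<Omega>" for \<beta>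
  proof -
    have "card (u `` {\<beta>} \<inter> (u\<inverse>)\<inverse> `` {\<beta>}) = card (u `` {\<alpha>} \<inter> (u\<inverse>)\<inverse> `` {\<alpha>})"
      using assms(2) that
      by (intro intersection_numbers[OF assms(1) transpose[OF assms(1)] diagonal_basic] Id_onI)
    then show ?thesis
      by (simp only: converse_converse Int_absorb)
  qed
  show ?thesis
    unfolding valency_def
  proof (rule the_equality)
    show "\<forall>\<beta>\<in>\<Omega>. card (u `` {\<beta>}) = card (u `` {\<alpha>})"
      using const by blast
  next
    fix n assume "\<forall>\<beta>\<in>\<Omega>. card (u `` {\<beta>}) = n"
    from bspec[OF this assms(2)] show "n = card (u `` {\<alpha>})" by (rule sym)
  qed
qed

definition basic_of_valency :: "'a set \<Rightarrow> 'a rel set \<Rightarrow> nat \<Rightarrow> 'a rel set" where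
  "basic_of_valency \<Omega> S m = {u \<in> S. valency \<Omega> u = m}"

locale quasi_thin_scheme = scheme +
  assumes quasi_thin: "S = basic_of_valency \<Omega> S 1 \<union> basic_of_valency \<Omega> S 2"

text \<open>The complex product \<open>uv\<close>, a set of basic relations.\<close>

definition complex_product :: "'a rel set \<Rightarrow> 'a rel \<Rightarrow> 'a rel \<Rightarrow> 'a rel set" where
  "complex_product S u v = {w \<in> S. w \<subseteq> u O v}"

text \<open>The relation \<open>u\<^sup>\<bottom>\<close>, meaningful for thick \<open>u\<close> in a quasi-thin scheme.\<close>

definition orthogonal :: "'a set \<Rightarrow> 'a rel set \<Rightarrow> 'a rel \<Rightarrow> 'a rel" where
  "orthogonal \<Omega> S u = (THE r. r \<in> S \<and> complex_product S u (u\<inverse>) = {Id_on \<Omega>, r})"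

lemma orthogonal_eq:
  assumes "r \<in> S" "complex_product S u (u\<inverse>) = {Id_on \<Omega>, r}"
  shows "orthogonal \<Omega> S u = r"
  unfolding orthogonal_def
  by (rule the_equality) (use assms in \<open>simp, metis doubleton_eq_iff\<close>)

definition orthogonals :: "'a set \<Rightarrow> 'a rel set \<Rightarrow> 'a rel set" where
  "orthogonals \<Omega> S = orthogonal \<Omega> S ` basic_of_valency \<Omega> S 2"

text \<open>
  A permutation group on \<open>\<Omega>\<close> is a subgroup of \<open>BijGroup \<Omega>\<close>; it acts on \<open>\<Omega> \<times> \<Omega>\<close>
  componentwise.
\<close>

definition schurian :: "'a set \<Rightarrow> 'a rel set \<Rightarrow> bool" where
  "schurian \<Omega> S \<longleftrightarrow>
    (\<exists>G. subgroup G (BijGroup \<Omega>) \<and>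
      S = orbits (BijGroup \<Omega>\<lparr>carrier := G\<rparr>) (\<Omega> \<times> \<Omega>) (\<lambda>g. \<lambda>p \<in> \<Omega> \<times> \<Omega>. map_prod g g p))"

definition algebraic_isomorphism :: "'a rel set \<Rightarrow> 'b rel set \<Rightarrow> ('a rel \<Rightarrow> 'b rel) \<Rightarrow> bool" where
  "algebraic_isomorphism S S' \<phi> \<longleftrightarrow>
    bij_betw \<phi> S S' \<and>
    (\<forall>u\<in>S. \<forall>v\<in>S. \<forall>w\<in>S.
      intersection_number u v w = intersection_number (\<phi> u) (\<phi> v) (\<phi> w))"

text \<open>
  HOL cannot quantify over types inside a definition, so the type of the points of the other
  configuration \<open>(\<Omega>', S')\<close> is a parameter. A theorem that concludes \<open>separable TYPE('b) \<Omega> S\<close>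
  with \<open>'b\<close> a free type variable covers coherent configurations on points of every type.
\<close>

definition separable :: "'b itself \<Rightarrow> 'a set \<Rightarrow> 'a rel set \<Rightarrow> bool" where
  "separable (_ :: 'b itself) \<Omega> S \<longleftrightarrow>
    (\<forall>(\<Omega>' :: 'b set) S' \<phi>.
      coherent_configuration \<Omega>' S' \<and> algebraic_isomorphism S S' \<phi> \<longrightarrow>
      (\<exists>f. bij_betw f \<Omega> \<Omega>' \<and> (\<forall>u\<in>S. map_prod f f ` u = \<phi> u)))"

end

theory Submission
  imports Defs
begin

text \<open>
  If all thick relations have the same orthogonal \<open>s\<close>, then two distinct points of a
  neighbourhood \<open>\<alpha>u\<close> always form a pair in \<open>s\<close>. Thin relations have a single
  neighbour at each point, so a map preserving the colours of pairs on a set \<open>B\<close> of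
  representatives for the orbits of the group of thin relations extends uniquely to all points.
  If \<open>s\<close> is thin, the thick relations between different orbits do not distinguish a point
  from its \<open>s\<close>-neighbour, so once \<open>\<alpha>\<close> is sent to \<open>\<alpha>'\<close>, a representative in \<open>\<alpha>u\<close> can be sent to
  any point of \<open>\<alpha>'\<phi>(u)\<close>. If \<open>s\<close> is thick, \<open>{\<alpha>} \<union> \<alpha>w\<close> is a set of representatives for every thick \<open>w\<close>.
  Either way an algebraic isomorphism is induced by a bijection that moreover takes a given
  pair in \<open>w\<close> to a given pair in \<open>\<phi>(w)\<close>. This is separability, and applied to the identity
  it shows that the automorphism group is transitive on every basic relation.
\<close>

section \<open>Elementary facts on coherent configurations and schemes\<close>

context coherent_configuration
begin

lemma basic_points: "u \<in> S \<Longrightarrow> (x, y) \<in> u \<Longrightarrow> x \<in> \<Omega> \<and> y \<in> \<Omega>"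
  using partition by (auto simp: partition_on_def)

lemma basic_unique: "u \<in> S \<Longrightarrow> v \<in> S \<Longrightarrow> p \<in> u \<Longrightarrow> p \<in> v \<Longrightarrow> u = v"
  using partition by (auto simp: partition_on_def disjoint_def)

lemma basic_cover: "x \<in> \<Omega> \<Longrightarrow> y \<in> \<Omega> \<Longrightarrow> \<exists>u\<in>S. (x, y) \<in> u"
  using partition by (auto simp: partition_on_def)

lemma basic_nonempty: "u \<in> S \<Longrightarrow> \<exists>x y. (x, y) \<in> u"
  using partition_onD3[OF partition] by (metis ex_in_conv surj_pair)

lemma finite_neighbours: "u \<in> S \<Longrightarrow> finite (u `` {x})"
  using basic_points by (intro finite_subset[OF _ finite_points]) auto

lemma finite_basic: "finite S"
  using partition finite_points
  by (intro finite_subset[of S "Pow (\<Omega> \<times> \<Omega>)"]) (auto simp: partition_on_def)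

lemma intersection_number_pos:
  assumes "u \<in> S" "v \<in> S" "w \<in> S" "(x, z) \<in> w"
  shows "intersection_number u v w > 0 \<longleftrightarrow> (\<exists>y. (x, y) \<in> u \<and> (y, z) \<in> v)"
  using finite_neighbours[OF assms(1), of x]
  by (auto simp: intersection_number_eq[OF assms] card_gt_0_iff)

lemma product_witness:
  assumes "u \<in> S" "v \<in> S" "w \<in> S" "(x, y) \<in> u" "(y, z) \<in> v" "(x, z) \<in> w" "(x', z') \<in> w"
  shows "\<exists>y'. (x', y') \<in> u \<and> (y', z') \<in> v"
  using intersection_number_pos[of u v w x z] intersection_number_pos[of u v w x' z'] assms by blast

end

context scheme
begin

lemma basic_diagonal: "u \<in> S \<Longrightarrow> (x, x) \<in> u \<Longrightarrow> u = Id_on \<Omega>"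
  using basic_unique[of u "Id_on \<Omega>" "(x, x)"] diagonal_basic basic_points by blast

lemma points_nonempty: "\<Omega> \<noteq> {}"
  using basic_nonempty[OF diagonal_basic] by auto

lemma valency_diagonal: "valency \<Omega> (Id_on \<Omega>) = 1"
proof -
  obtain x where x: "x \<in> \<Omega>" using points_nonempty by auto
  then have "Id_on \<Omega> `` {x} = {x}" by auto
  then show ?thesis using valency_eq[OF diagonal_basic x] by simp
qed

text \<open>Double counting: a basic relation has \<open>card \<Omega>\<close> times its valency
  many pairs, and transposition keeps the number of pairs.\<close>

lemma valency_converse:
  assumes "u \<in> S" shows "valency \<Omega> (u\<inverse>) = valency \<Omega> u"
proof -
  have card_basic: "card r = card \<Omega> * valency \<Omega> r" if r: "r \<in> S" for r
  proof -
    have "r = (SIGMA x:\<Omega>. r `` {x})" using basic_points[OF r] by auto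
    then have "card r = (\<Sum>x\<in>\<Omega>. card (r `` {x}))"
      using card_SigmaI[OF finite_points, of "\<lambda>x. r `` {x}"] finite_neighbours[OF r] by auto
    then show ?thesis by (simp add: valency_eq[OF r, symmetric])
  qed
  have "card (u\<inverse>) = card u" by (rule card_inverse)
  moreover have "card \<Omega> > 0" using points_nonempty finite_points by (simp add: card_gt_0_iff)
  ultimately show ?thesis
    using card_basic[OF assms] card_basic[OF transpose[OF assms]] by simp
qed

lemma thin_unique:
  assumes "u \<in> S" "valency \<Omega> u = 1" "(x, y) \<in> u" "(x, z) \<in> u"
  shows "y = z"
proof -
  have "card (u `` {x}) = 1" using valency_eq assms basic_points by metis
  then show ?thesis using assms by (metis ImageI card_1_singletonE singletonD singletonI)
qed

lemma thin_neighbour: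
  assumes "u \<in> S" "valency \<Omega> u = 1" "x \<in> \<Omega>"
  obtains y where "(x, y) \<in> u"
proof -
  have "card (u `` {x}) = 1" using valency_eq assms by metis
  then show ?thesis using that by (auto simp: card_1_singleton_iff)
qed

text \<open>Every \<open>w\<close>-neighbour \<open>z'\<close> of \<open>y\<close> is reached by a
  step of \<open>u\<inverse>\<close> followed by a step of \<open>v\<close>, since this is so for
  \<open>z\<close>. Both steps are thin, so \<open>z'\<close> is determined by
  \<open>y\<close>.\<close>

lemma thin_composition:
  assumes "u \<in> S" "v \<in> S" "w \<in> S" "valency \<Omega> u = 1" "valency \<Omega> v = 1"
    and "(x, y) \<in> u" "(x, z) \<in> v" "(y, z) \<in> w"
  shows "valency \<Omega> w = 1"
proof -
  have "z' = z" if z': "(y, z') \<in> w" for z'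
  proof -
    obtain a where "(y, a) \<in> u\<inverse>" "(a, z') \<in> v"
      using product_witness[of "u\<inverse>" v w y x z y z'] assms transpose z' by auto
    moreover have "valency \<Omega> (u\<inverse>) = 1" using assms valency_converse by simp
    ultimately have "a = x" using thin_unique[of "u\<inverse>" y a x] assms transpose by auto
    then show ?thesis using \<open>(a, z') \<in> v\<close> thin_unique assms by metis
  qed
  then have "w `` {y} = {z}" using assms(8) by blast
  then show ?thesis using valency_eq[OF assms(3), of y] basic_points[OF assms(3,8)] by simp
qed

lemma thick_neighbours:
  assumes "u \<in> S" "valency \<Omega> u = 2" "(x, y) \<in> u"
  obtains z where "z \<noteq> y" "(x, z) \<in> u" "\<And>t. (x, t) \<in> u \<Longrightarrow> t = y \<or> t = z"
proof -
  have "card (u `` {x}) = 2" using valency_eq assms basic_points by metis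
  then obtain a b where ab: "u `` {x} = {a, b}" "a \<noteq> b" by (auto simp: card_2_iff)
  then have "y = a \<or> y = b" using assms(3) by auto
  then show ?thesis
  proof
    assume "y = a" then show ?thesis using ab by (intro that[of b]) auto
  next
    assume "y = b" then show ?thesis using ab by (intro that[of a]) auto
  qed
qed

end

section \<open>Orthogonals in quasi-thin schemes\<close>

lemma (in quasi_thin_scheme) valency_cases:
  "u \<in> S \<Longrightarrow> valency \<Omega> u = 1 \<or> valency \<Omega> u = 2"
  using quasi_thin by (auto simp: basic_of_valency_def)

text \<open>The converse appears because \<open>u\<inverse> O u\<close> relates the points with a
  common \<open>u\<close>-predecessor. All such pairs of distinct points turn out to lie in one
  basic relation \<open>r\<close>, which is then the relation picked out by
  \<open>orthogonal\<close>.\<close>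

lemma (in quasi_thin_scheme) orthogonal_mem:
  assumes u: "u \<in> S" and xy: "(a, x) \<in> u" "(a, y) \<in> u" "x \<noteq> y"
  shows "u\<inverse> \<in> basic_of_valency \<Omega> S 2" "orthogonal \<Omega> S (u\<inverse>) \<in> S"
    "(x, y) \<in> orthogonal \<Omega> S (u\<inverse>)"
proof -
  have thick: "valency \<Omega> u = 2" using thin_unique[OF u _ xy(1,2)] valency_cases[OF u] xy(3) by auto
  show "u\<inverse> \<in> basic_of_valency \<Omega> S 2"
    using thick u by (simp add: basic_of_valency_def transpose valency_converse)
  obtain r where r: "r \<in> S" "(x, y) \<in> r" using basic_cover basic_points u xy by meson
  note T = transpose[OF u]
  have pair: "(p, q) \<in> r" if pq: "(b, p) \<in> u" "(b, q) \<in> u" "p \<noteq> q" for b p q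
  proof -
    \<comment> \<open>The triangle on \<open>a\<close>, \<open>x\<close>, \<open>y\<close> is copied
      over the pair \<open>(b, q)\<close>. Its new vertex is a \<open>u\<close>-neighbour of
      \<open>b\<close> other than \<open>q\<close>, and valency 2 leaves only
      \<open>p\<close>.\<close>
    obtain p' where p': "(b, p') \<in> u" "(p', q) \<in> r"
      using product_witness[OF u r(1) u xy(1) r(2) xy(2) pq(2)] by auto
    have "p' \<noteq> q" using basic_diagonal[OF r(1)] p'(2) r(2) xy(3) by auto
    then have "p' = p" using thick_neighbours[OF u thick pq(2)] p'(1) pq by metis
    then show ?thesis using p' by simp
  qed
  have "complex_product S (u\<inverse>) ((u\<inverse>)\<inverse>) = {Id_on \<Omega>, r}"
  proof (intro Set.set_eqI iffI)
    fix w assume "w \<in> complex_product S (u\<inverse>) ((u\<inverse>)\<inverse>)"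
    then have w: "w \<in> S" "w \<subseteq> u\<inverse> O u" by (auto simp: complex_product_def)
    obtain p q where pq: "(p, q) \<in> w" using basic_nonempty[OF w(1)] by auto
    then obtain b where b: "(b, p) \<in> u" "(b, q) \<in> u" using w(2) by auto
    show "w \<in> {Id_on \<Omega>, r}"
    proof (cases "p = q")
      case True
      then show ?thesis using basic_diagonal[OF w(1)] pq by auto
    next
      case False
      then show ?thesis using pair[OF b] basic_unique[OF w(1) r(1) pq] by auto
    qed
  next
    fix w assume "w \<in> {Id_on \<Omega>, r}"
    moreover have "Id_on \<Omega> \<subseteq> u\<inverse> O u"
    proof
      fix e assume "e \<in> Id_on \<Omega>"
      then obtain p where p: "p \<in> \<Omega>" "e = (p, p)" by auto
      have "(x, x) \<in> Id_on \<Omega>" using basic_points[OF u xy(1)] by auto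
      then show "e \<in> u\<inverse> O u"
        using product_witness[OF T u diagonal_basic, of x a x p p] xy(1) p by auto
    qed
    moreover have "r \<subseteq> u\<inverse> O u"
    proof
      fix e assume "e \<in> r"
      then show "e \<in> u\<inverse> O u"
        using product_witness[OF T u r(1), of x a y "fst e" "snd e"] xy r(2) by (cases e) auto
    qed
    ultimately show "w \<in> complex_product S (u\<inverse>) ((u\<inverse>)\<inverse>)"
      using r(1) diagonal_basic by (auto simp: complex_product_def)
  qed
  then show "orthogonal \<Omega> S (u\<inverse>) \<in> S" "(x, y) \<in> orthogonal \<Omega> S (u\<inverse>)"
    using orthogonal_eq[OF r(1)] r by simp_all
qed

text \<open>Formulated through points rather than through \<open>orthogonals\<close>, so that the
  property transfers along algebraic isomorphisms and also makes sense for a scheme without thick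
  relations.\<close>

locale single_orthogonal_scheme = quasi_thin_scheme +
  fixes s
  assumes s_basic: "s \<in> S"
    and common_orthogonal:
      "\<lbrakk>u \<in> S; (a, x) \<in> u; (a, y) \<in> u; x \<noteq> y\<rbrakk> \<Longrightarrow> (x, y) \<in> s"

lemma (in quasi_thin_scheme) single_orthogonalI:
  assumes "card (orthogonals \<Omega> S) \<le> 1"
  shows "\<exists>s. single_orthogonal_scheme \<Omega> S s"
proof -
  have fin: "finite (orthogonals \<Omega> S)"
    unfolding orthogonals_def basic_of_valency_def using finite_basic by simp
  show ?thesis
  proof (cases "\<exists>u a x y. u \<in> S \<and> (a, x) \<in> u \<and> (a, y) \<in> u \<and> x \<noteq> y")
    case True
    then obtain v b p q where v: "v \<in> S" "(b, p) \<in> v" "(b, q) \<in> v" "p \<noteq> q" by blast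
    define s where "s = orthogonal \<Omega> S (v\<inverse>)"
    have "s \<in> orthogonals \<Omega> S"
      using orthogonal_mem(1)[OF v] by (simp add: s_def orthogonals_def)
    then have same: "r = s" if "r \<in> orthogonals \<Omega> S" for r
      using assms that card_le_Suc0_iff_eq[OF fin] by auto
    have all: "(x, y) \<in> s" if "u \<in> S" "(a, x) \<in> u" "(a, y) \<in> u" "x \<noteq> y" for u a x y
      using orthogonal_mem[OF that] same[of "orthogonal \<Omega> S (u\<inverse>)"] by (auto simp: orthogonals_def)
    show ?thesis
    proof (intro exI)
      show "single_orthogonal_scheme \<Omega> S s"
        using all orthogonal_mem(2)[OF v] by unfold_locales (auto simp: s_def)
    qed
  next
    case False
    \<comment> \<open>Here every neighbourhood has at most one point, so any basic relation can
      serve as \<open>s\<close>; the diagonal is the one at hand.\<close>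
    then have "single_orthogonal_scheme \<Omega> S (Id_on \<Omega>)"
      using diagonal_basic by unfold_locales blast+
    then show ?thesis ..
  qed
qed

section \<open>Algebraic isomorphisms and partial maps that realise them\<close>

locale algebraic_isomorphism_pair =
  source: scheme \<Omega> S + target: coherent_configuration \<Omega>' S'
  for \<Omega> :: "'a set" and S and \<Omega>' :: "'b set" and S' and \<phi> +
  assumes algebraic_iso: "algebraic_isomorphism S S' \<phi>"
begin

lemma \<phi>_mem: "u \<in> S \<Longrightarrow> \<phi> u \<in> S'"
  using algebraic_iso by (auto simp: algebraic_isomorphism_def bij_betw_def)

lemma \<phi>_inj: "u \<in> S \<Longrightarrow> v \<in> S \<Longrightarrow> \<phi> u = \<phi> v \<Longrightarrow> u = v"
  using algebraic_iso by (auto simp: algebraic_isomorphism_def bij_betw_def inj_on_def)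

lemma \<phi>_surj: "u' \<in> S' \<Longrightarrow> \<exists>u\<in>S. \<phi> u = u'"
  using algebraic_iso by (auto simp: algebraic_isomorphism_def bij_betw_def)

lemma \<phi>_number:
  "u \<in> S \<Longrightarrow> v \<in> S \<Longrightarrow> w \<in> S \<Longrightarrow>
    intersection_number (\<phi> u) (\<phi> v) (\<phi> w) = intersection_number u v w"
  using algebraic_iso by (auto simp: algebraic_isomorphism_def)

lemma target_cover: "x \<in> \<Omega>' \<Longrightarrow> y \<in> \<Omega>' \<Longrightarrow> \<exists>u\<in>S. (x, y) \<in> \<phi> u"
  using target.basic_cover \<phi>_surj by metis

text \<open>An intersection number is positive exactly when the triangle exists, so equality of the
  numbers moves triangles in both directions.\<close>

lemma transfer_product:
  assumes "u \<in> S" "v \<in> S" "w \<in> S" "(x, z) \<in> w" "(x', z') \<in> \<phi> w"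
  shows "(\<exists>y. (x, y) \<in> u \<and> (y, z) \<in> v) \<longleftrightarrow> (\<exists>y'. (x', y') \<in> \<phi> u \<and> (y', z') \<in> \<phi> v)"
  using source.intersection_number_pos[OF assms(1-4)]
    target.intersection_number_pos[OF \<phi>_mem \<phi>_mem \<phi>_mem assms(5)] \<phi>_number assms(1-3)
  by simp

text \<open>The target is only known to be coherent, so this is what makes it a scheme. A basic
  relation \<open>d\<close> inside the diagonal and containing \<open>(x, x)\<close> is some
  \<open>\<phi> v\<close>. Since \<open>v\<close> lies in the product of the diagonal with
  \<open>v\<close>, there is a step of \<open>\<phi> (Id_on \<Omega>)\<close> from \<open>x\<close>
  followed by a step of \<open>d\<close> back to \<open>x\<close>; the second step does not move, so
  the first is \<open>(x, x)\<close>.\<close>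

lemma \<phi>_diagonal: "\<phi> (Id_on \<Omega>) = Id_on \<Omega>'"
proof -
  let ?e = "\<phi> (Id_on \<Omega>)"
  have e: "?e \<in> S'" using \<phi>_mem source.diagonal_basic .
  have refl: "(x, x) \<in> ?e" if x: "x \<in> \<Omega>'" for x
  proof -
    obtain T where T: "T \<subseteq> S'" "Id_on \<Omega>' = \<Union>T" using target.diagonal by auto
    have "(x, x) \<in> \<Union>T" using x T(2)[symmetric] by auto
    then obtain d where d: "d \<in> S'" "d \<subseteq> Id_on \<Omega>'" "(x, x) \<in> d" using T by blast
    obtain v where v: "v \<in> S" "\<phi> v = d" using \<phi>_surj d(1) by blast
    obtain a b where ab: "(a, b) \<in> v" using source.basic_nonempty[OF v(1)] by blast
    have "(a, a) \<in> Id_on \<Omega>" using source.basic_points[OF v(1) ab] by auto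
    then obtain y where "(x, y) \<in> ?e" "(y, x) \<in> d"
      using transfer_product[OF source.diagonal_basic v(1) v(1) ab, of x x] v d ab by auto
    then show ?thesis using d(2) by auto
  qed
  obtain T where T: "T \<subseteq> S'" "Id_on \<Omega>' = \<Union>T" using target.diagonal by auto
  have "?e \<subseteq> Id_on \<Omega>'"
  proof -
    obtain x y where xy: "(x, y) \<in> ?e" using target.basic_nonempty[OF e] by blast
    then have x: "x \<in> \<Omega>'" using target.basic_points[OF e] by blast
    then have "(x, x) \<in> \<Union>T" using T(2)[symmetric] by auto
    then obtain d where d: "d \<in> T" "(x, x) \<in> d" by blast
    then have "d = ?e" using target.basic_unique[OF _ e, of d] T(1) refl[OF x] by blast
    then show ?thesis using d T by blast
  qed
  then show ?thesis using refl by auto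
qed

sublocale target: scheme \<Omega>' S'
  using \<phi>_diagonal \<phi>_mem[OF source.diagonal_basic] by unfold_locales simp

text \<open>A step of \<open>u\<close> followed by one of \<open>u\<inverse>\<close> can return to
  its start. Transferring this puts one pair into both relations, and basic relations that meet are
  equal.\<close>

lemma \<phi>_converse:
  assumes u: "u \<in> S" shows "\<phi> (u\<inverse>) = (\<phi> u)\<inverse>"
proof -
  obtain x y where xy: "(x, y) \<in> u" using source.basic_nonempty[OF u] by blast
  obtain x' y' where xy': "(x', y') \<in> \<phi> u" using target.basic_nonempty[OF \<phi>_mem[OF u]] by blast
  have "(x, x) \<in> Id_on \<Omega>" "(x', x') \<in> \<phi> (Id_on \<Omega>)"
    using source.basic_points[OF u xy] target.basic_points[OF \<phi>_mem[OF u] xy'] \<phi>_diagonal by auto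
  then obtain z where "(x', z) \<in> \<phi> u" "(z, x') \<in> \<phi> (u\<inverse>)"
    using transfer_product[OF u source.transpose[OF u] source.diagonal_basic, of x x x' x'] xy by auto
  then show ?thesis
    using target.basic_unique[of "\<phi> (u\<inverse>)" "(\<phi> u)\<inverse>" "(z, x')"] \<phi>_mem source.transpose
      target.transpose u by auto
qed

lemma \<phi>_valency:
  assumes u: "u \<in> S" shows "valency \<Omega>' (\<phi> u) = valency \<Omega> u"
proof -
  obtain x where x: "x \<in> \<Omega>" using source.points_nonempty by auto
  obtain x' where x': "x' \<in> \<Omega>'" using target.points_nonempty by auto
  have "valency \<Omega> u = intersection_number u (u\<inverse>) (Id_on \<Omega>)"
    using source.valency_eq[OF u x] Id_onI[OF x] source.diagonal_basic u
      source.intersection_number_eq[of u "u\<inverse>" "Id_on \<Omega>" x x] source.transpose by auto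
  moreover have "valency \<Omega>' (\<phi> u) = intersection_number (\<phi> u) ((\<phi> u)\<inverse>) (Id_on \<Omega>')"
    using target.valency_eq[OF \<phi>_mem[OF u] x'] Id_onI[OF x'] target.diagonal_basic \<phi>_mem[OF u]
      target.intersection_number_eq[of "\<phi> u" "(\<phi> u)\<inverse>" "Id_on \<Omega>'" x' x'] target.transpose by auto
  ultimately show ?thesis
    using \<phi>_number[OF u source.transpose[OF u] source.diagonal_basic] u
    by (simp add: \<phi>_diagonal \<phi>_converse)
qed

text \<open>For \<open>B \<subseteq> \<Omega>\<close> these are the partial isomorphisms realising
  \<open>\<phi>\<close>. Injectivity is not demanded: it follows because \<open>\<phi>\<close> sends
  only the diagonal to the diagonal.\<close>

definition preserves :: "'a set \<Rightarrow> ('a \<Rightarrow> 'b) \<Rightarrow> bool" where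
  "preserves B f \<longleftrightarrow>
    f ` B \<subseteq> \<Omega>' \<and> (\<forall>x\<in>B. \<forall>y\<in>B. \<forall>u\<in>S. (x, y) \<in> u \<longrightarrow> (f x, f y) \<in> \<phi> u)"

lemma preservesD: "preserves B f \<Longrightarrow> u \<in> S \<Longrightarrow> x \<in> B \<Longrightarrow> y \<in> B \<Longrightarrow> (x, y) \<in> u \<Longrightarrow> (f x, f y) \<in> \<phi> u"
  by (auto simp: preserves_def)

lemma preserves_induces:
  assumes f: "preserves \<Omega> f"
  shows "bij_betw f \<Omega> \<Omega>'" "\<forall>u\<in>S. map_prod f f ` u = \<phi> u"
proof -
  have img: "f x \<in> \<Omega>'" if "x \<in> \<Omega>" for x using f that by (auto simp: preserves_def)
  have colour: "(x, y) \<in> u" if xy: "x \<in> \<Omega>" "y \<in> \<Omega>" and u: "u \<in> S" "(f x, f y) \<in> \<phi> u" for x y u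
  proof -
    obtain v where v: "v \<in> S" "(x, y) \<in> v" using source.basic_cover[OF xy] by blast
    then have "(f x, f y) \<in> \<phi> v" using preservesD[OF f v(1) xy] by blast
    then have "\<phi> u = \<phi> v"
      using target.basic_unique[OF \<phi>_mem[OF u(1)] \<phi>_mem[OF v(1)] u(2)] by blast
    then show ?thesis using \<phi>_inj[OF u(1) v(1)] v(2) by blast
  qed
  have inj: "inj_on f \<Omega>"
  proof (rule inj_onI)
    fix x y assume "x \<in> \<Omega>" "y \<in> \<Omega>" "f x = f y"
    then have "(x, y) \<in> Id_on \<Omega>"
      using colour[of x y "Id_on \<Omega>"] source.diagonal_basic \<phi>_diagonal img by auto
    then show "x = y" by auto
  qed
  \<comment> \<open>Surjectivity is local: \<open>f\<close> embeds each \<open>u\<close>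
    {x}\<open>into\<close>\<phi> u \<open>{f x}\<close>, the two sets have the same size, and the
    latter sets cover \<open>\<Omega>'\<close> as \<open>u\<close> varies.\<close>
  have surj: "y' \<in> f ` \<Omega>" if y': "y' \<in> \<Omega>'" for y'
  proof -
    obtain x where x: "x \<in> \<Omega>" using source.points_nonempty by auto
    obtain u where u: "u \<in> S" "(f x, y') \<in> \<phi> u" using target_cover[OF img[OF x] y'] by blast
    have sub: "f ` (u `` {x}) \<subseteq> \<phi> u `` {f x}"
      using preservesD[OF f u(1) x] source.basic_points[OF u(1)] by auto
    have "inj_on f (u `` {x})"
      by (rule inj_on_subset[OF inj]) (use source.basic_points[OF u(1)] in auto)
    then have "card (f ` (u `` {x})) = card (\<phi> u `` {f x})"
      using card_image source.valency_eq[OF u(1) x] \<phi>_valency[OF u(1)]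
        target.valency_eq[OF \<phi>_mem[OF u(1)] img[OF x]] by metis
    then have "f ` (u `` {x}) = \<phi> u `` {f x}"
      using card_subset_eq[OF target.finite_neighbours[OF \<phi>_mem[OF u(1)]] sub] by simp
    then have "y' \<in> f ` (u `` {x})" using u(2) by blast
    then show ?thesis using source.basic_points[OF u(1)] by auto
  qed
  show bij: "bij_betw f \<Omega> \<Omega>'" using inj surj img by (auto simp: bij_betw_def)
  show "\<forall>u\<in>S. map_prod f f ` u = \<phi> u"
  proof (intro ballI subset_antisym subsetI)
    fix u p assume u: "u \<in> S" and "p \<in> map_prod f f ` u"
    then show "p \<in> \<phi> u" using preservesD[OF f u] source.basic_points[OF u] by auto
  next
    fix u p assume u: "u \<in> S" and p: "p \<in> \<phi> u"
    obtain x' y' where p': "p = (x', y')" by (cases p)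
    then obtain x y where "x \<in> \<Omega>" "y \<in> \<Omega>" "x' = f x" "y' = f y"
      using target.basic_points[OF \<phi>_mem[OF u]] p surj by blast
    then show "p \<in> map_prod f f ` u" using colour[of x y u] u p p' by force
  qed
qed

text \<open>As \<open>v\<close> is thin, \<open>x'\<close> is the only
  \<open>\<phi> v\<close>-neighbour of \<open>b'\<close>, so the vertex of the transferred triangle
  can only be \<open>x'\<close>. This moves one endpoint of a pair along a thin relation.\<close>

lemma thin_step:
  assumes "v \<in> S" "valency \<Omega> v = 1" "t \<in> S" "q \<in> S"
    and "(b, x) \<in> v" "(b', x') \<in> \<phi> v" "(b, c) \<in> t" "(b', c') \<in> \<phi> t" "(x, c) \<in> q"
  shows "(x', c') \<in> \<phi> q"
proof -
  obtain y where "(b', y) \<in> \<phi> v" "(y, c') \<in> \<phi> q"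
    using transfer_product[OF assms(1,4,3,7,8)] assms(5,9) by blast
  moreover have "y = x'"
    using target.thin_unique[OF \<phi>_mem[OF assms(1)] _ \<open>(b', y) \<in> \<phi> v\<close> assms(6)] assms(1,2)
    by (simp add: \<phi>_valency)
  ultimately show ?thesis by simp
qed

text \<open>The image of \<open>x\<close> is forced to be the \<open>\<phi> v\<close>-neighbour of
  \<open>g b\<close>. \<open>P\<close> collects the candidates over all choices of \<open>b\<close>
  and \<open>v\<close>; \<open>colour\<close> shows that any candidates are compatible with each
  other. Applied to the diagonal, it shows that candidates for one point coincide, so the extension
  agrees with \<open>g\<close> on \<open>B\<close>.\<close>

lemma preserves_extend:
  assumes g: "preserves B g" and B: "B \<subseteq> \<Omega>"
    and cover: "\<And>x. x \<in> \<Omega> \<Longrightarrow> \<exists>b\<in>B. \<exists>v\<in>S. valency \<Omega> v = 1 \<and> (b, x) \<in> v"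
  obtains f where "preserves \<Omega> f" "\<And>b. b \<in> B \<Longrightarrow> f b = g b"
proof -
  define P where "P x y \<longleftrightarrow> (\<exists>b\<in>B. \<exists>v\<in>S. valency \<Omega> v = 1 \<and> (b, x) \<in> v \<and> (g b, y) \<in> \<phi> v)" for x y
  have colour: "(x', y') \<in> \<phi> u" if P: "P x x'" "P y y'" and u: "u \<in> S" "(x, y) \<in> u" for x x' y y' u
  proof -
    obtain b v where b: "b \<in> B" "v \<in> S" "valency \<Omega> v = 1" "(b, x) \<in> v" "(g b, x') \<in> \<phi> v"
      using P(1) by (auto simp: P_def)
    obtain c z where c: "c \<in> B" "z \<in> S" "valency \<Omega> z = 1" "(c, y) \<in> z" "(g c, y') \<in> \<phi> z"
      using P(2) by (auto simp: P_def)
    obtain t where t: "t \<in> S" "(b, c) \<in> t" using source.basic_cover B b c by blast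
    obtain q where q: "q \<in> S" "(x, c) \<in> q"
      using source.basic_cover B c source.basic_points[OF u] by blast
    \<comment> \<open>Two thin steps: the first endpoint moves from \<open>b\<close> to
      \<open>x\<close>, then, after transposition, the other one from \<open>c\<close> to
      \<open>y\<close>.\<close>
    have "(x', g c) \<in> \<phi> q"
      using thin_step[OF b(2,3) t(1) q(1) b(4,5) t(2) _ q(2)] preservesD[OF g t(1) b(1) c(1) t(2)] by blast
    then have "(g c, x') \<in> \<phi> (q\<inverse>)" using \<phi>_converse[OF q(1)] by simp
    then have "(y', x') \<in> \<phi> (u\<inverse>)"
      using thin_step[OF c(2,3) source.transpose[OF q(1)] source.transpose[OF u(1)] c(4,5), of x x']
        q u by simp
    then show ?thesis using \<phi>_converse[OF u(1)] by simp
  qed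
  have "\<exists>y\<in>\<Omega>'. P x y" if x: "x \<in> \<Omega>" for x
  proof -
    obtain b v where b: "b \<in> B" "v \<in> S" "valency \<Omega> v = 1" "(b, x) \<in> v" using cover[OF x] by blast
    have "g b \<in> \<Omega>'" using g b(1) by (auto simp: preserves_def)
    then obtain y where y: "(g b, y) \<in> \<phi> v"
      using target.thin_neighbour[OF \<phi>_mem[OF b(2)]] \<phi>_valency[OF b(2)] b(3) by metis
    then show ?thesis using b target.basic_points[OF \<phi>_mem[OF b(2)] y] by (auto simp: P_def)
  qed
  then obtain f where f: "\<And>x. x \<in> \<Omega> \<Longrightarrow> f x \<in> \<Omega>' \<and> P x (f x)" by metis
  have "preserves \<Omega> f" unfolding preserves_def using f colour by blast
  moreover have "f b = g b" if b: "b \<in> B" for b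
  proof -
    have bb: "(b, b) \<in> Id_on \<Omega>" using b B by auto
    have "(g b, g b) \<in> \<phi> (Id_on \<Omega>)"
      using preservesD[OF g source.diagonal_basic b b bb] .
    then have "P b (g b)"
      using b bb source.diagonal_basic source.valency_diagonal by (auto simp: P_def)
    then have "(f b, g b) \<in> \<phi> (Id_on \<Omega>)"
      using colour[OF _ _ source.diagonal_basic bb] f[of b] b B by blast
    then show ?thesis using \<phi>_diagonal by auto
  qed
  ultimately show ?thesis using that by blast
qed

end

section \<open>Transfer of the single orthogonal, and the thin case\<close>

locale single_orthogonal_pair =
  source: single_orthogonal_scheme \<Omega> S s + algebraic_isomorphism_pair \<Omega> S \<Omega>' S' \<phi>
  for \<Omega> :: "'a set" and S and s and \<Omega>' :: "'b set" and S' and \<phi>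
begin

text \<open>The relation of \<open>(x, y)\<close> is some \<open>\<phi> t\<close>. Pulling the
  common predecessor back to a pair in \<open>t\<close> shows that \<open>t\<close> is
  \<open>s\<close>.\<close>

lemma target_common_orthogonal:
  assumes u: "u \<in> S" and xy: "(a, x) \<in> \<phi> u" "(a, y) \<in> \<phi> u" "x \<noteq> y"
  shows "(x, y) \<in> \<phi> s"
proof -
  obtain t where t: "t \<in> S" "(x, y) \<in> \<phi> t"
    using target_cover target.basic_points[OF \<phi>_mem[OF u]] xy by meson
  obtain p q where pq: "(p, q) \<in> t" using source.basic_nonempty[OF t(1)] by blast
  obtain b where b: "(b, p) \<in> u" "(b, q) \<in> u"
    using transfer_product[OF source.transpose[OF u] u t(1) pq t(2)] xy \<phi>_converse[OF u] by auto
  have "p \<noteq> q"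
    using source.basic_diagonal[OF t(1)] pq t(2) \<phi>_diagonal xy(3) by auto
  then have "(p, q) \<in> s" using source.common_orthogonal[OF u b] by simp
  then have "t = s" using source.basic_unique[OF t(1) source.s_basic pq] by simp
  then show ?thesis using t by simp
qed

sublocale target: single_orthogonal_scheme \<Omega>' S' "\<phi> s"
proof unfold_locales
  have "valency \<Omega>' u' = 1 \<or> valency \<Omega>' u' = 2" if "u' \<in> S'" for u'
    using \<phi>_surj[OF that] \<phi>_valency source.valency_cases by metis
  then show "S' = basic_of_valency \<Omega>' S' 1 \<union> basic_of_valency \<Omega>' S' 2"
    by (auto simp: basic_of_valency_def)
  show "\<phi> s \<in> S'" using \<phi>_mem[OF source.s_basic] .
  show "(x, y) \<in> \<phi> s" if "u' \<in> S'" "(a, x) \<in> u'" "(a, y) \<in> u'" "x \<noteq> y" for u' a x y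
    using \<phi>_surj[OF that(1)] target_common_orthogonal that by blast
qed

text \<open>The triangle on \<open>\<alpha>\<close>, \<open>b\<close>, \<open>c\<close> transfers to
  one with some vertex \<open>y\<close> in place of \<open>g b\<close>. If they differ, then
  \<open>g b\<close> is the \<open>s\<close>-mate of \<open>y\<close>, meaning its unique
  \<open>\<phi> s\<close>-neighbour. As \<open>t\<close> is thick, \<open>g c\<close> has a second
  neighbour in the converse of \<open>\<phi> t\<close>, and that is also the \<open>s\<close>-mate
  of \<open>y\<close>. Hence \<open>g b\<close> stands in the right relation to \<open>g c\<close>
  as well.\<close>

lemma preserves_if_s_thin:
  assumes s: "valency \<Omega> s = 1" and C: "C \<subseteq> \<Omega>"
    and indep: "\<And>b c u. \<lbrakk>b \<in> C; c \<in> C; b \<noteq> c; u \<in> S; (b, c) \<in> u\<rbrakk> \<Longrightarrow> valency \<Omega> u = 2"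
    and g: "\<And>c u. \<lbrakk>c \<in> C; u \<in> S; (\<alpha>, c) \<in> u\<rbrakk> \<Longrightarrow> (\<alpha>', g c) \<in> \<phi> u"
    and \<alpha>: "\<alpha> \<in> \<Omega>"
  shows "preserves C g"
proof -
  have img: "g c \<in> \<Omega>'" if c: "c \<in> C" for c
  proof -
    obtain u where u: "u \<in> S" "(\<alpha>, c) \<in> u" using source.basic_cover[OF \<alpha>] c C by blast
    then show ?thesis using g[OF c u] target.basic_points[OF \<phi>_mem[OF u(1)]] by blast
  qed
  have "(g b, g c) \<in> \<phi> t" if b: "b \<in> C" and c: "c \<in> C" and t: "t \<in> S" "(b, c) \<in> t" for b c t
  proof (cases "b = c")
    case True
    then have "t = Id_on \<Omega>" using source.basic_diagonal t by blast
    then show ?thesis using True img[OF c] \<phi>_diagonal by auto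
  next
    case False
    obtain u where u: "u \<in> S" "(\<alpha>, b) \<in> u" using source.basic_cover[OF \<alpha>] b C by blast
    obtain w where w: "w \<in> S" "(\<alpha>, c) \<in> w" using source.basic_cover[OF \<alpha>] c C by blast
    obtain y where y: "(\<alpha>', y) \<in> \<phi> u" "(y, g c) \<in> \<phi> t"
      using transfer_product[OF u(1) t(1) w g[OF c w]] u t by blast
    show ?thesis
    proof (cases "y = g b")
      case True
      then show ?thesis using y by simp
    next
      case y_neq: False
      then have 1: "(y, g b) \<in> \<phi> s"
        using target_common_orthogonal[OF u(1) y(1) g[OF b u]] by simp
      have ct: "(\<phi> t)\<inverse> \<in> S'" using target.transpose[OF \<phi>_mem[OF t(1)]] .
      have "valency \<Omega>' ((\<phi> t)\<inverse>) = 2"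
        using target.valency_converse[OF \<phi>_mem[OF t(1)]] \<phi>_valency[OF t(1)] indep[OF b c False t] by simp
      then obtain x where x: "x \<noteq> y" "(g c, x) \<in> (\<phi> t)\<inverse>"
        using target.thick_neighbours[OF ct, of "g c" y] y(2) by auto
      then have "(y, x) \<in> \<phi> s"
        using target.common_orthogonal[OF ct _ x(2), of y] y(2) by auto
      then have "x = g b"
        using target.thin_unique[OF \<phi>_mem[OF source.s_basic] _ _ 1] \<phi>_valency[OF source.s_basic] s by auto
      then show ?thesis using x by simp
    qed
  qed
  then show ?thesis using img by (auto simp: preserves_def)
qed

end

section \<open>Triangles of a thick orthogonal\<close>

text \<open>For a thick \<open>s\<close>, the two neighbours of \<open>a\<close> in a thick relation complete to an
  \<open>s\<close>-triangle whose third vertex is in thin relation to \<open>a\<close>.\<close>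

lemma (in single_orthogonal_scheme) third_vertex:
  assumes s: "valency \<Omega> s = 2" and w: "w \<in> S"
    and xy: "(a, x) \<in> w" "(a, y) \<in> w" "x \<noteq> y"
  obtains z v where "v \<in> S" "valency \<Omega> v = 1" "(a, z) \<in> v" "z \<noteq> x" "z \<noteq> y"
    "(x, z) \<in> s" "(y, z) \<in> s" "(z, x) \<in> s" "(z, y) \<in> s"
proof -
  have xys: "(x, y) \<in> s" using common_orthogonal[OF w xy] .
  obtain z where z: "z \<noteq> y" "(x, z) \<in> s" using thick_neighbours[OF s_basic s xys] by metis
  have neq: "z \<noteq> x" using basic_diagonal[OF s_basic] z(2) xys xy(3) by auto
  have yz: "(y, z) \<in> s" "(z, y) \<in> s"
    using common_orthogonal[OF s_basic xys z(2)] common_orthogonal[OF s_basic z(2) xys] z(1) by auto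
  have yx: "(y, x) \<in> s" using common_orthogonal[OF w xy(2,1)] xy(3) by simp
  have zx: "(z, x) \<in> s" using common_orthogonal[OF s_basic yz(1) yx] neq by simp
  obtain v where v: "v \<in> S" "(a, z) \<in> v"
    using basic_cover basic_points[OF w xy(1)] basic_points[OF s_basic z(2)] by meson
  \<comment> \<open>Otherwise the second \<open>v\<close>-neighbour of \<open>a\<close> is an
    \<open>s\<close>-neighbour of \<open>z\<close>, hence \<open>x\<close> or \<open>y\<close>. Then
    \<open>v = w\<close>, and \<open>z\<close> would be a third \<open>w\<close>-neighbour of
    \<open>a\<close>.\<close>
  have "valency \<Omega> v = 1"
  proof (rule ccontr)
    assume "valency \<Omega> v \<noteq> 1"
    then have "valency \<Omega> v = 2" using valency_cases[OF v(1)] by simp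
    then obtain z' where z': "z' \<noteq> z" "(a, z') \<in> v" using thick_neighbours[OF v(1) _ v(2)] by metis
    have "(z, z') \<in> s" using common_orthogonal[OF v z'(2)] z'(1) by simp
    then have "z' = x \<or> z' = y" using thick_neighbours[OF s_basic s zx] yz(2) xy(3) by metis
    then have "v = w" using basic_unique[OF v(1) w] z'(2) xy by metis
    moreover have "valency \<Omega> w = 2" using thin_unique[OF w _ xy(1,2)] valency_cases[OF w] xy(3) by auto
    ultimately have "z = x \<or> z = y" using thick_neighbours[OF w _ xy(1)] v(2) xy(2,3) by metis
    then show False using neq z(1) by simp
  qed
  then show ?thesis using that[OF v(1) _ v(2)] z neq yz zx by simp
qed

text \<open>If \<open>p\<close> is in thick relation to \<open>a\<close>, then \<open>{x, y}\<close>
  and the neighbourhood of \<open>a\<close> containing \<open>p\<close> have third vertices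
  \<open>z\<close> and \<open>z'\<close>, both in thin relation to \<open>a\<close> and so joined by
  a thin \<open>t\<close>. Moving along \<open>t\<close> takes the \<open>s\<close>-neighbours
  \<open>x\<close>, \<open>y\<close> of \<open>z\<close> to the two \<open>s\<close>-neighbours of
  \<open>z'\<close>, one of which is \<open>p\<close>.\<close>

lemma (in single_orthogonal_scheme) cover_if_s_thick:
  assumes s: "valency \<Omega> s = 2" and w: "w \<in> S"
    and xy: "(a, x) \<in> w" "(a, y) \<in> w" "x \<noteq> y" and p: "p \<in> \<Omega>"
  shows "\<exists>b\<in>{a, x, y}. \<exists>v\<in>S. valency \<Omega> v = 1 \<and> (b, p) \<in> v"
proof -
  obtain u where u: "u \<in> S" "(a, p) \<in> u" using basic_cover basic_points[OF w xy(1)] p by meson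
  show ?thesis
  proof (cases "valency \<Omega> u = 1")
    case True
    then show ?thesis using u by blast
  next
    case False
    then have "valency \<Omega> u = 2" using valency_cases[OF u(1)] by simp
    then obtain q where q: "q \<noteq> p" "(a, q) \<in> u" using thick_neighbours[OF u(1) _ u(2)] by metis
    obtain z v where z: "v \<in> S" "valency \<Omega> v = 1" "(a, z) \<in> v" "z \<noteq> x" "z \<noteq> y"
      "(x, z) \<in> s" "(y, z) \<in> s" "(z, x) \<in> s" "(z, y) \<in> s"
      using third_vertex[OF s w xy] by metis
    obtain z' v' where z': "v' \<in> S" "valency \<Omega> v' = 1" "(a, z') \<in> v'" "(z', p) \<in> s"
      using third_vertex[OF s u(1) q(2) u(2) q(1)] by metis
    obtain t where t: "t \<in> S" "(z, z') \<in> t"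
      using basic_cover basic_points[OF z(1,3)] basic_points[OF z'(1,3)] by meson
    have t1: "valency \<Omega> t = 1" using thin_composition[OF z(1) z'(1) t(1) z(2) z'(2) z(3) z'(3) t(2)] .
    have T: "t\<inverse> \<in> S" "valency \<Omega> (t\<inverse>) = 1" using transpose[OF t(1)] valency_converse[OF t(1)] t1 by simp_all
    \<comment> \<open>The triangle on \<open>e\<close>, \<open>z'\<close>, \<open>z\<close> is
      copied over \<open>(e, d)\<close>, which makes \<open>z'\<close> and \<open>k\<close> two
      distinct neighbours of \<open>e\<close> in the same relation \<open>r\<close>.\<close>
    have shifted: "(z', k) \<in> s" if e: "(e, z) \<in> s" "(e, d) \<in> s" "d \<noteq> z" and k: "(d, k) \<in> t" for d e k
    proof -
      obtain r where r: "r \<in> S" "(e, z') \<in> r"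
        using basic_cover basic_points[OF s_basic e(1)] basic_points[OF t] by meson
      obtain k' where k': "(e, k') \<in> r" "(k', d) \<in> t\<inverse>"
        using product_witness[OF r(1) T(1) s_basic r(2) _ e(1,2)] t(2) by auto
      then have "k' = k" using thin_unique[OF t(1) t1 _ k] by auto
      moreover have "k \<noteq> z'" using thin_unique[OF T, of z' d z] k t(2) e(3) by auto
      ultimately show ?thesis using common_orthogonal[OF r] k'(1) by auto
    qed
    obtain x' where x': "(x, x') \<in> t" using thin_neighbour[OF t(1) t1] basic_points[OF w xy(1)] by blast
    obtain y' where y': "(y, y') \<in> t" using thin_neighbour[OF t(1) t1] basic_points[OF w xy(2)] by blast
    have "(x, y) \<in> s" "(y, x) \<in> s"
      using common_orthogonal[OF w] xy by auto
    then have "(z', x') \<in> s" "(z', y') \<in> s"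
      using shifted[OF z(7) _ _ x'] shifted[OF z(6) _ _ y'] z(4,5) by auto
    moreover have "x' \<noteq> y'" using thin_unique[OF T, of x' x y] x' y' xy(3) by auto
    ultimately have "p = x' \<or> p = y'" using thick_neighbours[OF s_basic s] z'(4) by metis
    then show ?thesis using x' y' t(1) t1 by blast
  qed
qed

section \<open>Homogeneity: realising a prescribed pair\<close>

context single_orthogonal_pair
begin

lemma homogeneous_thick:
  assumes w: "w \<in> S" "valency \<Omega> w = 2" "(\<alpha>, \<delta>) \<in> w" "(\<alpha>', \<delta>') \<in> \<phi> w"
  obtains f where "preserves \<Omega> f" "f \<alpha> = \<alpha>'" "f \<delta> = \<delta>'"
proof (cases "valency \<Omega> s = 1")
  case True
  have pts: "\<alpha> \<in> \<Omega>" "\<delta> \<in> \<Omega>" "\<alpha>' \<in> \<Omega>'"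
    using source.basic_points[OF w(1,3)] target.basic_points[OF \<phi>_mem[OF w(1)] w(4)] by auto
  \<comment> \<open>Being in thin relation is an equivalence whose classes are the orbits of the
    thin relations. A maximal set of pairwise inequivalent points is a transversal, and it can be
    chosen to contain both \<open>\<alpha>\<close> and \<open>\<delta>\<close> because
    \<open>w\<close> is thick.\<close>
  define indep where "indep C \<longleftrightarrow>
    (\<forall>b\<in>C. \<forall>c\<in>C. \<forall>u\<in>S. b \<noteq> c \<longrightarrow> (b, c) \<in> u \<longrightarrow> valency \<Omega> u = 2)" for C
  have "{C. C \<subseteq> \<Omega> \<and> indep C} \<subseteq> Pow \<Omega>" by auto
  then have fin: "finite {C. C \<subseteq> \<Omega> \<and> indep C}" using source.finite_points finite_subset by blast
  have w': "valency \<Omega> u = 2" if "u \<in> S" "(\<alpha>, \<delta>) \<in> u \<or> (\<delta>, \<alpha>) \<in> u" for u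
    using that(2)
  proof
    assume "(\<alpha>, \<delta>) \<in> u" then show ?thesis using source.basic_unique[OF w(1) that(1) w(3)] w(2) by simp
  next
    assume "(\<delta>, \<alpha>) \<in> u"
    then have "w\<inverse> = u" using source.basic_unique[OF source.transpose[OF w(1)] that(1)] w(3) by auto
    then show ?thesis using source.valency_converse[OF w(1)] w(2) by simp
  qed
  have "{\<alpha>, \<delta>} \<in> {C. C \<subseteq> \<Omega> \<and> indep C}" using pts w' by (auto simp: indep_def)
  then obtain C where C: "C \<subseteq> \<Omega>" "indep C" "{\<alpha>, \<delta>} \<subseteq> C"
    and max: "\<And>D. D \<subseteq> \<Omega> \<Longrightarrow> indep D \<Longrightarrow> C \<subseteq> D \<Longrightarrow> C = D"
    using finite_has_maximal2[OF fin] by (metis (no_types, lifting) mem_Collect_eq)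
  have cover: "\<exists>b\<in>C. \<exists>v\<in>S. valency \<Omega> v = 1 \<and> (b, x) \<in> v" if x: "x \<in> \<Omega>" for x
  proof (rule ccontr)
    assume no: "\<not> (\<exists>b\<in>C. \<exists>v\<in>S. valency \<Omega> v = 1 \<and> (b, x) \<in> v)"
    then have 1: "valency \<Omega> v = 2" if "b \<in> C" "v \<in> S" "(b, x) \<in> v" for b v
      using that source.valency_cases by blast
    have 2: "valency \<Omega> v = 2" if "b \<in> C" "v \<in> S" "(x, b) \<in> v" for b v
      using 1[OF that(1) source.transpose[OF that(2)]] that(3) source.valency_converse[OF that(2)] by simp
    have "indep (insert x C)" using C(2) 1 2 unfolding indep_def by blast
    then have "x \<in> C" using max[of "insert x C"] x C(1) by blast
    then have "valency \<Omega> (Id_on \<Omega>) = 2" using 1 source.diagonal_basic x by blast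
    then show False using source.valency_diagonal by simp
  qed
  have "\<exists>y. \<forall>u\<in>S. (\<alpha>, c) \<in> u \<longrightarrow> (\<alpha>', y) \<in> \<phi> u" if c: "c \<in> \<Omega>" for c
  proof -
    obtain u where u: "u \<in> S" "(\<alpha>, c) \<in> u" using source.basic_cover pts c by blast
    have "(\<alpha>, \<alpha>) \<in> Id_on \<Omega>" "(\<alpha>', \<alpha>') \<in> \<phi> (Id_on \<Omega>)" using pts \<phi>_diagonal by auto
    then obtain y where "(\<alpha>', y) \<in> \<phi> u"
      using transfer_product[OF u(1) source.transpose[OF u(1)] source.diagonal_basic, of \<alpha> \<alpha> \<alpha>' \<alpha>'] u by auto
    then show ?thesis using source.basic_unique[OF u(1) _ u(2)] by blast
  qed
  then obtain h where h: "\<And>c u. c \<in> \<Omega> \<Longrightarrow> u \<in> S \<Longrightarrow> (\<alpha>, c) \<in> u \<Longrightarrow> (\<alpha>', h c) \<in> \<phi> u" by metis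
  \<comment> \<open>Any images with the right relation to \<open>\<alpha>'\<close> are allowed on
    \<open>C\<close>, so the value at \<open>\<delta>\<close> can be prescribed.\<close>
  define g where "g = h(\<delta> := \<delta>')"
  have g: "(\<alpha>', g c) \<in> \<phi> u" if "c \<in> \<Omega>" "u \<in> S" "(\<alpha>, c) \<in> u" for c u
    using h[OF that] that w(4) source.basic_unique[OF w(1) that(2) w(3)] by (auto simp: g_def)
  have "preserves C g"
    using preserves_if_s_thin[OF True C(1) _ _ pts(1), where g = g] C(1,2) g
    unfolding indep_def by (metis subsetD)
  then obtain f where f: "preserves \<Omega> f" "\<And>b. b \<in> C \<Longrightarrow> f b = g b"
    using preserves_extend C(1) cover by metis
  have "(\<alpha>', g \<alpha>) \<in> \<phi> (Id_on \<Omega>)" using g[OF pts(1) source.diagonal_basic] pts by auto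
  then have "f \<alpha> = \<alpha>'" using f(2)[of \<alpha>] C(3) \<phi>_diagonal by auto
  moreover have "f \<delta> = \<delta>'" using f(2)[of \<delta>] C(3) g_def by auto
  ultimately show ?thesis using that f(1) by blast
next
  case False
  then have s: "valency \<Omega> s = 2" using source.valency_cases[OF source.s_basic] by simp
  obtain \<epsilon> where \<epsilon>: "\<epsilon> \<noteq> \<delta>" "(\<alpha>, \<epsilon>) \<in> w" using source.thick_neighbours[OF w(1-3)] by metis
  have "valency \<Omega>' (\<phi> w) = 2" using \<phi>_valency w by simp
  then obtain \<epsilon>' where \<epsilon>': "\<epsilon>' \<noteq> \<delta>'" "(\<alpha>', \<epsilon>') \<in> \<phi> w"
    using target.thick_neighbours[OF \<phi>_mem[OF w(1)] _ w(4)] by metis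
  have pts: "\<alpha> \<in> \<Omega>" "\<delta> \<in> \<Omega>" "\<epsilon> \<in> \<Omega>" "\<alpha>' \<in> \<Omega>'" "\<delta>' \<in> \<Omega>'" "\<epsilon>' \<in> \<Omega>'"
    using source.basic_points[OF w(1)] w(3) \<epsilon> target.basic_points[OF \<phi>_mem[OF w(1)]] w(4) \<epsilon>' by auto
  have "w \<noteq> Id_on \<Omega>" using w(2) source.valency_diagonal by auto
  then have neq: "\<delta> \<noteq> \<alpha>" "\<epsilon> \<noteq> \<alpha>" using source.basic_diagonal[OF w(1)] w(3) \<epsilon>(2) by auto
  \<comment> \<open>The constant \<open>\<alpha>'\<close> supplies the value at
    \<open>\<alpha>\<close>, which \<open>neq\<close> protects from the two updates.\<close>
  define g where "g = (\<lambda>_. \<alpha>')(\<delta> := \<delta>', \<epsilon> := \<epsilon>')"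
  have g: "g \<alpha> = \<alpha>'" "g \<delta> = \<delta>'" "g \<epsilon> = \<epsilon>'" using neq \<epsilon>(1) by (auto simp: g_def)
  have s_pairs: "(\<delta>, \<epsilon>) \<in> s" "(\<epsilon>, \<delta>) \<in> s" "(\<delta>', \<epsilon>') \<in> \<phi> s" "(\<epsilon>', \<delta>') \<in> \<phi> s"
    using source.common_orthogonal[OF w(1)] w(3) \<epsilon> target_common_orthogonal[OF w(1)] w(4) \<epsilon>' by auto
  have known: "\<exists>u\<in>S. (x, y) \<in> u \<and> (g x, g y) \<in> \<phi> u" if "x \<in> {\<alpha>, \<delta>, \<epsilon>}" "y \<in> {\<alpha>, \<delta>, \<epsilon>}" for x y
  proof -
    have "?thesis" if "x = y"
      using that \<open>x \<in> {\<alpha>, \<delta>, \<epsilon>}\<close> pts g source.diagonal_basic \<phi>_diagonal by (intro bexI[of _ "Id_on \<Omega>"]) auto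
    moreover have "?thesis" if "x = \<alpha>" "y \<in> {\<delta>, \<epsilon>}"
      using that w \<epsilon> \<epsilon>' g by (intro bexI[of _ w]) auto
    moreover have "?thesis" if "y = \<alpha>" "x \<in> {\<delta>, \<epsilon>}"
      using that w \<epsilon> \<epsilon>' g \<phi>_converse[OF w(1)] source.transpose[OF w(1)]
      by (intro bexI[of _ "w\<inverse>"]) auto
    moreover have "?thesis" if "x \<in> {\<delta>, \<epsilon>}" "y \<in> {\<delta>, \<epsilon>}" "x \<noteq> y"
      using that s_pairs g source.s_basic by (intro bexI[of _ s]) auto
    ultimately show ?thesis using that by blast
  qed
  have "(g x, g y) \<in> \<phi> u" if "x \<in> {\<alpha>, \<delta>, \<epsilon>}" "y \<in> {\<alpha>, \<delta>, \<epsilon>}" "u \<in> S" "(x, y) \<in> u" for x y u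
    using known[OF that(1,2)] source.basic_unique[OF that(3) _ that(4)] by blast
  then have "preserves {\<alpha>, \<delta>, \<epsilon>} g" using g pts by (simp add: preserves_def)
  moreover have "{\<alpha>, \<delta>, \<epsilon>} \<subseteq> \<Omega>" using pts by simp
  ultimately obtain f where f: "preserves \<Omega> f" "\<And>b. b \<in> {\<alpha>, \<delta>, \<epsilon>} \<Longrightarrow> f b = g b"
    using preserves_extend source.cover_if_s_thick[OF s w(1) w(3) \<epsilon>(2) \<epsilon>(1)[symmetric]] by metis
  then show ?thesis using that[OF f(1)] g by simp
qed

text \<open>For a thin \<open>w\<close> the image of \<open>\<delta>\<close> is forced by that of
  \<open>\<alpha>\<close>, so it suffices to send \<open>\<alpha>\<close> to
  \<open>\<alpha>'\<close>. A thick relation at \<open>\<alpha>\<close> achieves this by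
  \<open>homogeneous_thick\<close>; if all relations are thin, \<open>{\<alpha>}\<close> alone is a
  transversal.\<close>

lemma homogeneous:
  assumes w: "w \<in> S" "(\<alpha>, \<delta>) \<in> w" "(\<alpha>', \<delta>') \<in> \<phi> w"
  obtains f where "preserves \<Omega> f" "f \<alpha> = \<alpha>'" "f \<delta> = \<delta>'"
proof (cases "valency \<Omega> w = 2")
  case True
  then show ?thesis using homogeneous_thick[OF w(1) True w(2,3)] that by metis
next
  case False
  then have thin: "valency \<Omega> w = 1" using source.valency_cases[OF w(1)] by simp
  have pts: "\<alpha> \<in> \<Omega>" "\<delta> \<in> \<Omega>" "\<alpha>' \<in> \<Omega>'"
    using source.basic_points[OF w(1,2)] target.basic_points[OF \<phi>_mem[OF w(1)] w(3)] by auto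
  obtain f where f: "preserves \<Omega> f" "f \<alpha> = \<alpha>'"
  proof (cases "\<exists>u\<in>S. valency \<Omega> u = 2")
    case True
    then obtain u where u: "u \<in> S" "valency \<Omega> u = 2" by blast
    have "u `` {\<alpha>} \<noteq> {}" "\<phi> u `` {\<alpha>'} \<noteq> {}"
      using source.valency_eq[OF u(1) pts(1)] target.valency_eq[OF \<phi>_mem[OF u(1)] pts(3)]
        \<phi>_valency[OF u(1)] u(2) by auto
    then obtain y y' where "(\<alpha>, y) \<in> u" "(\<alpha>', y') \<in> \<phi> u" by blast
    then show ?thesis using homogeneous_thick[OF u] that by metis
  next
    case none: False
    have "preserves {\<alpha>} (\<lambda>_. \<alpha>')"
      using pts \<phi>_diagonal source.basic_diagonal by (auto simp: preserves_def)
    moreover have "\<exists>b\<in>{\<alpha>}. \<exists>v\<in>S. valency \<Omega> v = 1 \<and> (b, x) \<in> v" if "x \<in> \<Omega>" for x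
      using source.basic_cover[OF pts(1) that] source.valency_cases none by blast
    ultimately show ?thesis using preserves_extend[of "{\<alpha>}" "\<lambda>_. \<alpha>'"] pts(1) that by blast
  qed
  have "(\<alpha>', f \<delta>) \<in> \<phi> w" using preservesD[OF f(1) w(1) pts(1,2) w(2)] f(2) by simp
  then have "f \<delta> = \<delta>'"
    using target.thin_unique[OF \<phi>_mem[OF w(1)] _ _ w(3)] \<phi>_valency[OF w(1)] thin by simp
  then show ?thesis using that f by blast
qed

end

section \<open>Separability and schurity\<close>

lemma (in single_orthogonal_scheme) separable: "separable TYPE('b) \<Omega> S"
  unfolding separable_def
proof (intro allI impI)
  fix \<Omega>' :: "'b set" and S' \<phi>
  assume "coherent_configuration \<Omega>' S' \<and> algebraic_isomorphism S S' \<phi>"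
  then interpret target: coherent_configuration \<Omega>' S' by simp
  interpret pair: single_orthogonal_pair \<Omega> S s \<Omega>' S' \<phi>
    by unfold_locales (use \<open>_ \<and> _\<close> in simp)
  obtain x y where xy: "(x, y) \<in> Id_on \<Omega>" using basic_nonempty[OF diagonal_basic] by blast
  obtain x' y' where xy': "(x', y') \<in> \<phi> (Id_on \<Omega>)"
    using target.basic_nonempty[OF pair.\<phi>_mem[OF diagonal_basic]] by blast
  obtain f where f: "pair.preserves \<Omega> f" using pair.homogeneous[OF diagonal_basic xy xy'] by metis
  then show "\<exists>f. bij_betw f \<Omega> \<Omega>' \<and> (\<forall>u\<in>S. map_prod f f ` u = \<phi> u)"
    using pair.preserves_induces by blast
qed

lemma (in single_orthogonal_scheme) schurian: "schurian \<Omega> S"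
proof -
  interpret pair: single_orthogonal_pair \<Omega> S s \<Omega> S "\<lambda>u. u"
    by unfold_locales (auto simp: algebraic_isomorphism_def bij_betw_def)
  \<comment> \<open>The full automorphism group. Elements of \<open>Bij \<Omega>\<close> are
    extensional, hence the restriction in \<open>memI\<close>.\<close>
  define G where "G = {g \<in> Bij \<Omega>. \<forall>u\<in>S. \<forall>x y. (x, y) \<in> u \<longrightarrow> (g x, g y) \<in> u}"
  have memI: "restrict f \<Omega> \<in> G" if f: "pair.preserves \<Omega> f" for f
  proof -
    have "bij_betw (restrict f \<Omega>) \<Omega> \<Omega>"
      using pair.preserves_induces(1)[OF f] bij_betw_cong[of \<Omega> "restrict f \<Omega>" f \<Omega>] by simp
    moreover have "(restrict f \<Omega> x, restrict f \<Omega> y) \<in> u" if "u \<in> S" "(x, y) \<in> u" for x y u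
      using pair.preservesD[OF f that(1) _ _ that(2)] basic_points[OF that] by simp
    ultimately show ?thesis by (auto simp: G_def Bij_def)
  qed
  have "subgroup G (BijGroup \<Omega>)"
  proof (rule group.subgroupI[OF group_BijGroup])
    show "G \<subseteq> carrier (BijGroup \<Omega>)" by (auto simp: G_def BijGroup_def)
    have "pair.preserves \<Omega> (\<lambda>x. x)" by (auto simp: pair.preserves_def)
    then show "G \<noteq> {}" using memI by blast
  next
    fix g assume g: "g \<in> G"
    then have gB: "g \<in> Bij \<Omega>" by (simp add: G_def)
    then have bij: "bij_betw g \<Omega> \<Omega>" by (simp add: Bij_def)
    have "(inv_into \<Omega> g x, inv_into \<Omega> g y) \<in> u" if u: "u \<in> S" "(x, y) \<in> u" for x y u
    proof -
      have in\<Omega>: "inv_into \<Omega> g x \<in> \<Omega>" "inv_into \<Omega> g y \<in> \<Omega>"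
        and inv: "g (inv_into \<Omega> g x) = x" "g (inv_into \<Omega> g y) = y"
        using basic_points[OF u] bij by (auto simp: bij_betw_def inv_into_into f_inv_into_f)
      obtain v where v: "v \<in> S" "(inv_into \<Omega> g x, inv_into \<Omega> g y) \<in> v"
        using basic_cover in\<Omega> by meson
      then have "(g (inv_into \<Omega> g x), g (inv_into \<Omega> g y)) \<in> v"
        using g unfolding G_def by blast
      then have "(x, y) \<in> v" by (simp only: inv)
      then show ?thesis using basic_unique[OF v(1) u(1)] u(2) v(2) by blast
    qed
    moreover have "inv_into \<Omega> g ` \<Omega> \<subseteq> \<Omega>"
      using bij by (auto simp: bij_betw_def inv_into_into)
    ultimately have "pair.preserves \<Omega> (inv_into \<Omega> g)" by (auto simp: pair.preserves_def)
    then have "restrict (inv_into \<Omega> g) \<Omega> \<in> G" by (rule memI)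
    then show "inv\<^bsub>BijGroup \<Omega>\<^esub> g \<in> G" using inv_BijGroup[OF gB] by simp
  next
    fix g h assume gh: "g \<in> G" "h \<in> G"
    then have "g \<in> Bij \<Omega>" "h \<in> Bij \<Omega>" by (auto simp: G_def)
    moreover have "(compose \<Omega> g h x, compose \<Omega> g h y) \<in> u" if u: "u \<in> S" "(x, y) \<in> u" for x y u
    proof -
      have "(g (h x), g (h y)) \<in> u" using gh u by (simp add: G_def)
      then show ?thesis using basic_points[OF u] by (simp add: compose_def)
    qed
    ultimately show "g \<otimes>\<^bsub>BijGroup \<Omega>\<^esub> h \<in> G"
      using compose_Bij[of g \<Omega> h] by (simp add: G_def BijGroup_def)
  qed
  moreover have "S = orbits (BijGroup \<Omega>\<lparr>carrier := G\<rparr>) (\<Omega> \<times> \<Omega>) (\<lambda>g. \<lambda>p \<in> \<Omega> \<times> \<Omega>. map_prod g g p)"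
    (is "S = orbits ?H ?E ?act")
  proof -
    \<comment> \<open>Automorphisms keep an orbit inside \<open>u\<close>; homogeneity for the
      identity isomorphism reaches every pair of \<open>u\<close>.\<close>
    have orb: "orbit ?H ?act (x, y) = u" if u: "u \<in> S" "(x, y) \<in> u" for x y u
    proof (intro subset_antisym subsetI)
      fix p assume "p \<in> orbit ?H ?act (x, y)"
      then obtain g where "g \<in> G" "p = (g x, g y)"
        using basic_points[OF u] by (auto simp: orbit_def)
      then show "p \<in> u" using u by (simp add: G_def)
    next
      fix p assume "p \<in> u"
      then obtain x' y' where p: "p = (x', y')" "(x', y') \<in> u" by (cases p) auto
      obtain f where f: "pair.preserves \<Omega> f" "f x = x'" "f y = y'"
        using pair.homogeneous[OF u p(2)] by metis
      then have "p = ?act (restrict f \<Omega>) (x, y)" using basic_points[OF u] p(1) by simp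
      then show "p \<in> orbit ?H ?act (x, y)" using memI[OF f(1)]
        unfolding orbit_def by (intro CollectI exI[of _ "restrict f \<Omega>"]) simp
    qed
    show ?thesis
    proof (intro subset_antisym subsetI)
      fix u assume u: "u \<in> S"
      then obtain x y where xy: "(x, y) \<in> u" using basic_nonempty by blast
      then show "u \<in> orbits ?H ?E ?act"
        using orb[OF u xy] basic_points[OF u xy] unfolding orbits_def by blast
    next
      fix u assume "u \<in> orbits ?H ?E ?act"
      then obtain x y where xy: "x \<in> \<Omega>" "y \<in> \<Omega>" and u: "u = orbit ?H ?act (x, y)"
        unfolding orbits_def by blast
      obtain v where v: "v \<in> S" "(x, y) \<in> v" using basic_cover[OF xy] by blast
      show "u \<in> S" unfolding u orb[OF v] by (rule v(1))
    qed
  qed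
  ultimately show ?thesis unfolding schurian_def by blast
qed

theorem theorem5p2:
  fixes \<Omega> :: "'a set" and S :: "'a rel set"
  assumes "quasi_thin_scheme \<Omega> S"
    and "card (orthogonals \<Omega> S) \<le> 1"
  shows "schurian \<Omega> S \<and> separable TYPE('b) \<Omega> S"
proof -
  obtain s where "single_orthogonal_scheme \<Omega> S s"
    using quasi_thin_scheme.single_orthogonalI assms by blast
  then show ?thesis
    using single_orthogonal_scheme.schurian single_orthogonal_scheme.separable by blast
qed

end
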